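(* Let $L$ be a finite-dimensional Leibniz algebra over an algebraically closed field. Then the following conditions are equivalent: (i) $L$ is modular; (ii) every subalgebra of $L$ is a weak quasi-ideal of $L$; (iii) $L$ is upper semi-modular.
   Context: A (right) Leibniz algebra over a field $F$ is a vector space $L$ with a bilinear product $[\cdot,\cdot]$ satisfying $[x,[y,z]]=[[x,y],z]-[[x,z],y]$ for all $x,y,z$. For subalgebras $U,V$, $\langle U,V\rangle$ denotes the subalgebra they generate. $L$ is modular if $\langle U,V\rangle\cap W=\langle U,V\cap W\rangle$ for all subalgebras $U,V,W$ of $L$ with $U\subseteq W$. A subalgebra $U$ of $L$ is a weak quasi-ideal of $L$ if $[U,V]+[V,U]\subseteq U+V$ for every subalgebra $V$ of $L$. A subalgebra $U$ of $L$ is upper semi-modular in $L$ if $U$ is a maximal subalgebra of $\langle U,B\rangle$ for every subalgebra $B$ of $L$ such that $U\cap B$ is a maximal subalgebra of $B$ (a maximal subalgebra is a maximal proper subalgebra). $L$ is upper semi-modular if every subalgebra of $L$ is upper semi-modular in $L$. *)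

theory Defs
  imports
    "HOL-Computational_Algebra.Polynomial"
    "HOL-Library.Set_Algebras"
begin

text \<open>The algebra is the whole type \<open>'b\<close>, as for \<^locale>\<open>vector_space\<close>.\<close>

locale leibniz_algebra = vector_space scale
  for scale :: "'a::field \<Rightarrow> 'b::ab_group_add \<Rightarrow> 'b" (infixr \<open>*s\<close> 75) +
  fixes bracket :: "'b \<Rightarrow> 'b \<Rightarrow> 'b"
  assumes linear_bracket_left: "Vector_Spaces.linear scale scale (\<lambda>x. bracket x y)"
    and linear_bracket_right: "Vector_Spaces.linear scale scale (\<lambda>y. bracket x y)"
    and leibniz: "bracket x (bracket y z) = bracket (bracket x y) z - bracket (bracket x z) y"
begin

definition subalgebra :: "'b set \<Rightarrow> bool" where
  "subalgebra U \<longleftrightarrow> subspace U \<and> (\<forall>x\<in>U. \<forall>y\<in>U. bracket x y \<in> U)"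

definition join :: "'b set \<Rightarrow> 'b set \<Rightarrow> 'b set" where
  "join U V = subalgebra hull (U \<union> V)"

definition bracket_space :: "'b set \<Rightarrow> 'b set \<Rightarrow> 'b set" where
  "bracket_space U V = span {bracket u v | u v. u \<in> U \<and> v \<in> V}"

definition maximal_subalgebra :: "'b set \<Rightarrow> 'b set \<Rightarrow> bool" where
  "maximal_subalgebra M A \<longleftrightarrow>
     subalgebra M \<and> subalgebra A \<and> M \<subset> A \<and>
     (\<forall>N. subalgebra N \<and> M \<subseteq> N \<and> N \<subset> A \<longrightarrow> N = M)"

definition modular :: bool where
  "modular \<longleftrightarrow>
     (\<forall>U V W. subalgebra U \<and> subalgebra V \<and> subalgebra W \<and> U \<subseteq> W \<longrightarrow>
        join U V \<inter> W = join U (V \<inter> W))"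

text \<open>Addition of sets is the elementwise sum of \<^theory>\<open>HOL-Library.Set_Algebras\<close>.\<close>

definition weak_quasi_ideal :: "'b set \<Rightarrow> bool" where
  "weak_quasi_ideal U \<longleftrightarrow>
     subalgebra U \<and>
     (\<forall>V. subalgebra V \<longrightarrow> bracket_space U V + bracket_space V U \<subseteq> U + V)"

definition upper_semi_modular_in :: "'b set \<Rightarrow> bool" where
  "upper_semi_modular_in U \<longleftrightarrow>
     subalgebra U \<and>
     (\<forall>B. subalgebra B \<and> maximal_subalgebra (U \<inter> B) B \<longrightarrow> maximal_subalgebra U (join U B))"

definition upper_semi_modular :: bool where
  "upper_semi_modular \<longleftrightarrow> (\<forall>U. subalgebra U \<longrightarrow> upper_semi_modular_in U)"

end

end

(* Condition (ii) makes U + V the join of U and V, so modularity is the modular law for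
   subspaces, and modular lattices are upper semi-modular. For (iii) ==> (ii) one has to show
   [x,y] \<in> <x> + <y>. Let Z be the set of k with [L,k] = 0: it is an abelian ideal containing
   all squares, so <x> = Fx + J with J = <x> \<inter> Z. Provided that U = <y> + J is a subalgebra
   and x is not in U, U \<inter> <x> = J is maximal in <x>, so U is maximal in S = <U,x>. As the
   field is algebraically closed, right multiplication by y has an eigenvector modulo U, and this
   forces U to have codimension one in S, whence [x,y] \<in> Fx + U. For x = k in Z one takes J = 0
   instead and obtains [k,y] \<in> Fk + <y>, which is what makes <y> + J a subalgebra in general. *)

theory Submission
  imports Defs
begin

section \<open>Polynomials in an endomorphism and eigenvectors modulo a subspace\<close>

locale fd_vector_space_over_alg_closed = finite_dimensional_vector_space scale Basis
  for scale :: "'a::alg_closed_field \<Rightarrow> 'b::ab_group_add \<Rightarrow> 'b" (infixr \<open>*s\<close> 75)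
    and Basis :: "'b set"
begin

text \<open>This is p(f) evaluated at v, written with iterates of f so that no algebra of
  endomorphisms has to be set up.\<close>

definition poly_apply :: "('b \<Rightarrow> 'b) \<Rightarrow> 'a poly \<Rightarrow> 'b \<Rightarrow> 'b" where
  "poly_apply f p v = (\<Sum>i\<le>degree p. coeff p i *s (f ^^ i) v)"

lemma poly_apply_eq:
  assumes "degree p \<le> n"
  shows "poly_apply f p v = (\<Sum>i\<le>n. coeff p i *s (f ^^ i) v)"
  unfolding poly_apply_def
  by (rule sum.mono_neutral_left) (use assms in \<open>auto simp: coeff_eq_0 not_le\<close>)

lemma poly_apply_linear_factor:
  assumes f: "Vector_Spaces.linear scale scale f"
  shows "poly_apply f ([:-c, 1:] * q) v = f (poly_apply f q v) - c *s poly_apply f q v"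
proof -
  interpret f: Vector_Spaces.linear scale scale f by (rule f)
  let ?n = "degree q"
  have eq: "[:-c, 1:] * q = pCons 0 q - smult c q" by simp
  have deg: "degree ([:-c, 1:] * q) \<le> Suc ?n"
    by (rule order.trans[OF degree_mult_le]) simp
  have "poly_apply f ([:-c, 1:] * q) v =
      (\<Sum>i\<le>Suc ?n. coeff (pCons 0 q) i *s (f ^^ i) v) - (\<Sum>i\<le>Suc ?n. coeff (smult c q) i *s (f ^^ i) v)"
    by (subst poly_apply_eq[OF deg]) (simp only: eq coeff_diff scale_left_diff_distrib sum_subtractf)
  \<comment> \<open>Multiplication by X shifts coefficients by one. The new constant coefficient is
    0, so after the index shift every remaining term carries one more application of f.\<close>
  also have "(\<Sum>i\<le>Suc ?n. coeff (pCons 0 q) i *s (f ^^ i) v) = f (poly_apply f q v)"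
    unfolding sum.atMost_Suc_shift poly_apply_def by (simp add: f.sum f.scale)
  also have "(\<Sum>i\<le>Suc ?n. coeff (smult c q) i *s (f ^^ i) v) = c *s poly_apply f q v"
    unfolding poly_apply_eq[OF le_SucI[OF order.refl]] scale_sum_right by simp
  finally show ?thesis .
qed

lemma poly_apply_in_subspace:
  assumes "subspace T" "\<And>x. x \<in> T \<Longrightarrow> f x \<in> T" "v \<in> T"
  shows "poly_apply f p v \<in> T"
proof -
  have "(f ^^ i) v \<in> T" for i by (induction i) (use assms in auto)
  then show ?thesis unfolding poly_apply_def by (intro subspace_sum subspace_scale assms(1))
qed

text \<open>The \<open>dimension\<close> + 1 iterates of v cannot be independent. As
  \<open>dependent\<close> speaks of sets and not of families, a repetition among the iterates would
  go unnoticed. It is treated apart and gives X^i - X^j.\<close>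

lemma exists_annihilating_poly: "\<exists>p. p \<noteq> 0 \<and> poly_apply f p v = 0"
proof (cases "inj_on (\<lambda>i. (f ^^ i) v) {..dimension}")
  case True
  let ?g = "\<lambda>i. (f ^^ i) v"
  have "dependent (?g ` {..dimension})"
    by (rule dependent_biggerset_general)
      (use dim_subset_UNIV[of "?g ` {..dimension}"] in \<open>simp add: card_image True\<close>)
  then obtain u w where u: "w \<in> ?g ` {..dimension}" "u w \<noteq> 0"
      "(\<Sum>w\<in>?g ` {..dimension}. u w *s w) = 0"
    by (auto simp: dependent_finite)
  define p where "p = (\<Sum>i\<le>dimension. monom (u (?g i)) i)"
  have coeff: "coeff p i = (if i \<le> dimension then u (?g i) else 0)" for i
    by (simp add: p_def coeff_sum)
  have "degree p \<le> dimension"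
    by (rule degree_le) (simp add: coeff)
  then have "poly_apply f p v = (\<Sum>i\<le>dimension. u (?g i) *s ?g i)"
    by (simp add: poly_apply_eq coeff)
  also have "\<dots> = 0"
    using u(3) by (simp add: sum.reindex True)
  finally have "poly_apply f p v = 0" .
  moreover obtain i where "i \<le> dimension" "w = ?g i" using u(1) by auto
  then have "coeff p i \<noteq> 0" using u(2) by (simp add: coeff)
  ultimately show ?thesis by (metis coeff_0)
next
  case False
  then obtain i j where ij: "i \<noteq> j" "(f ^^ i) v = (f ^^ j) v"
    by (auto simp: inj_on_def)
  define p :: "'a poly" where "p = monom 1 i - monom 1 j"
  have "coeff p i = 1" using ij by (simp add: p_def)
  then have "p \<noteq> 0" by auto
  have "degree p \<le> max i j"
    by (rule degree_le) (auto simp: p_def)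
  then have "poly_apply f p v =
      (\<Sum>k\<le>max i j. (if i = k then (f ^^ k) v else 0) - (if j = k then (f ^^ k) v else 0))"
    unfolding poly_apply_eq[OF \<open>degree p \<le> max i j\<close>]
    by (intro sum.cong) (auto simp: p_def)
  also have "\<dots> = 0"
    using ij by (simp add: sum_subtractf)
  finally show ?thesis using \<open>p \<noteq> 0\<close> by blast
qed

text \<open>An argument with minimal polynomials that avoids quotient spaces: take p of least degree
  among the nonzero polynomials that send t into U, and split off a root c as p = (X - c) q. By
  minimality z = q(f) t is outside U, while (f - c) z = p(f) t is in U.\<close>

lemma exists_eigenvector_mod_subspace:
  assumes f: "Vector_Spaces.linear scale scale f"
    and U: "subspace U"
    and T: "subspace T" "\<And>x. x \<in> T \<Longrightarrow> f x \<in> T"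
    and "\<not> T \<subseteq> U"
  shows "\<exists>z c. z \<in> T \<and> z \<notin> U \<and> f z - c *s z \<in> U"
proof -
  obtain t where t: "t \<in> T" "t \<notin> U" using \<open>\<not> T \<subseteq> U\<close> by blast
  define P where "P p \<longleftrightarrow> p \<noteq> 0 \<and> poly_apply f p t \<in> U" for p
  have "\<exists>p. P p"
    using exists_annihilating_poly[of f t] subspace_0[OF U] by (auto simp: P_def)
  then obtain p where p: "P p" and least: "\<And>q. P q \<Longrightarrow> degree p \<le> degree q"
    by (metis ex_has_least_nat)
  have "degree p \<noteq> 0"
  proof
    assume "degree p = 0"
    then obtain c where c: "p = [:c:]" by (rule degree_eq_zeroE)
    then have "c \<noteq> 0" "c *s t \<in> U" using p by (auto simp: P_def poly_apply_def)
    then have "inverse c *s (c *s t) \<in> U" using subspace_scale[OF U] by blast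
    then show False using t \<open>c \<noteq> 0\<close> by simp
  qed
  then obtain c where "poly p c = 0"
    using alg_closed_imp_poly_has_root by blast
  then obtain q where q: "p = [:-c, 1:] * q"
    by (metis dvdE poly_eq_0_iff_dvd)
  have "q \<noteq> 0" using p q by (auto simp: P_def)
  then have "degree p = Suc (degree q)"
    unfolding q by (subst degree_mult_eq) auto
  then have "\<not> P q" using least[of q] by auto
  then have "poly_apply f q t \<notin> U" using \<open>q \<noteq> 0\<close> by (simp add: P_def)
  moreover have "poly_apply f q t \<in> T"
    by (intro poly_apply_in_subspace T t)
  moreover have "f (poly_apply f q t) - c *s poly_apply f q t \<in> U"
    using p unfolding P_def q poly_apply_linear_factor[OF f] by blast
  ultimately show ?thesis by blast
qed

end

section \<open>Sums of subspaces, bilinearity of the bracket, and the lattice of subalgebras\<close>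

context leibniz_algebra
begin

lemma subspace_set_plus:
  assumes "subspace U" "subspace V"
  shows "subspace (U + V)"
proof -
  have "U + V = {x + y | x y. x \<in> U \<and> y \<in> V}" by (auto simp: set_plus_def)
  then show ?thesis using subspace_sums[OF assms] by simp
qed

lemma subset_set_plus_left: "subspace V \<Longrightarrow> U \<subseteq> U + V"
proof
  fix x assume "subspace V" "x \<in> U"
  then have "x + 0 \<in> U + V" by (intro set_plus_intro subspace_0)
  then show "x \<in> U + V" by simp
qed

lemma subset_set_plus_right: "subspace U \<Longrightarrow> V \<subseteq> U + V"
  using subset_set_plus_left[of U V] by (simp add: add.commute)

lemma bracket_add_left: "bracket (x + y) z = bracket x z + bracket y z"
  and bracket_diff_left: "bracket (x - y) z = bracket x z - bracket y z"
  and bracket_scale_left: "bracket (c *s x) z = c *s bracket x z"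
  and bracket_zero_left [simp]: "bracket 0 z = 0"
proof -
  interpret l: Vector_Spaces.linear scale scale "\<lambda>x. bracket x z" by (rule linear_bracket_left)
  show "bracket (x + y) z = bracket x z + bracket y z"
    "bracket (x - y) z = bracket x z - bracket y z"
    "bracket (c *s x) z = c *s bracket x z" "bracket 0 z = 0"
    by (fact l.add l.diff l.scale l.zero)+
qed

lemma bracket_add_right: "bracket z (x + y) = bracket z x + bracket z y"
  and bracket_diff_right: "bracket z (x - y) = bracket z x - bracket z y"
  and bracket_scale_right: "bracket z (c *s x) = c *s bracket z x"
  and bracket_zero_right [simp]: "bracket z 0 = 0"
proof -
  interpret l: Vector_Spaces.linear scale scale "\<lambda>x. bracket z x" by (rule linear_bracket_right)
  show "bracket z (x + y) = bracket z x + bracket z y"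
    "bracket z (x - y) = bracket z x - bracket z y"
    "bracket z (c *s x) = c *s bracket z x" "bracket z 0 = 0"
    by (fact l.add l.diff l.scale l.zero)+
qed

lemmas bracket_simps =
  bracket_add_left bracket_diff_left bracket_scale_left
  bracket_add_right bracket_diff_right bracket_scale_right

lemma subalgebraI:
  "subspace U \<Longrightarrow> (\<And>x y. x \<in> U \<Longrightarrow> y \<in> U \<Longrightarrow> bracket x y \<in> U) \<Longrightarrow> subalgebra U"
  by (simp add: subalgebra_def)

lemma subalgebra_subspace: "subalgebra U \<Longrightarrow> subspace U"
  and subalgebra_bracket: "subalgebra U \<Longrightarrow> x \<in> U \<Longrightarrow> y \<in> U \<Longrightarrow> bracket x y \<in> U"
  by (auto simp: subalgebra_def)

lemma subalgebra_Inter: "(\<And>U. U \<in> F \<Longrightarrow> subalgebra U) \<Longrightarrow> subalgebra (\<Inter>F)"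
  by (auto simp: subalgebra_def intro: subspace_Inter)

lemma subalgebra_Int: "subalgebra U \<Longrightarrow> subalgebra V \<Longrightarrow> subalgebra (U \<inter> V)"
  using subalgebra_Inter[of "{U, V}"] by auto

lemma subalgebra_hull: "subalgebra (subalgebra hull A)"
  by (rule hull_in) (rule subalgebra_Inter, auto)

lemma subalgebra_join: "subalgebra (join U V)"
  and join_upper1: "U \<subseteq> join U V"
  and join_upper2: "V \<subseteq> join U V"
  using hull_subset[of "U \<union> V" subalgebra] by (auto simp: join_def subalgebra_hull)

lemma join_least: "subalgebra W \<Longrightarrow> U \<subseteq> W \<Longrightarrow> V \<subseteq> W \<Longrightarrow> join U V \<subseteq> W"
  unfolding join_def by (intro hull_minimal) auto

section \<open>From weak quasi-ideals to modularity and on to upper semi-modularity\<close>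

lemma join_eq_set_plus:
  assumes "weak_quasi_ideal U" "subalgebra V"
  shows "join U V = U + V"
proof
  have U: "subalgebra U" and q: "bracket_space U V + bracket_space V U \<subseteq> U + V"
    using assms by (auto simp: weak_quasi_ideal_def)
  note sU = subalgebra_subspace[OF U] and sV = subalgebra_subspace[OF \<open>subalgebra V\<close>]
  have sUV: "subspace (U + V)" by (rule subspace_set_plus[OF sU sV])
  have uv: "bracket u v \<in> U + V" "bracket v u \<in> U + V" if "u \<in> U" "v \<in> V" for u v
  proof -
    have "bracket u v \<in> bracket_space U V" "bracket v u \<in> bracket_space V U"
      unfolding bracket_space_def by (rule span_base, use that in blast)+
    \<comment> \<open>The defining inclusion concerns the sum of the two bracket spaces, so a single
      bracket is fed into it with 0 as the other summand.\<close>
    moreover have "0 \<in> bracket_space U V" "0 \<in> bracket_space V U"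
      unfolding bracket_space_def by (rule span_zero)+
    ultimately have "bracket u v + 0 \<in> bracket_space U V + bracket_space V U"
      "0 + bracket v u \<in> bracket_space U V + bracket_space V U"
      by (simp_all only: set_plus_intro)
    then show "bracket u v \<in> U + V" "bracket v u \<in> U + V"
      using q by auto
  qed
  have UV: "U \<subseteq> U + V" "V \<subseteq> U + V"
    by (rule subset_set_plus_left[OF sV], rule subset_set_plus_right[OF sU])
  have "subalgebra (U + V)"
  proof (rule subalgebraI[OF sUV])
    fix x y assume "x \<in> U + V" "y \<in> U + V"
    obtain a b where x: "x = a + b" "a \<in> U" "b \<in> V"
      using \<open>x \<in> U + V\<close> by (rule set_plus_elim)
    obtain c d where y: "y = c + d" "c \<in> U" "d \<in> V"
      using \<open>y \<in> U + V\<close> by (rule set_plus_elim)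
    have "bracket a c \<in> U + V" "bracket b d \<in> U + V"
      using x(2,3) y(2,3) UV subalgebra_bracket[OF U] subalgebra_bracket[OF \<open>subalgebra V\<close>] by blast+
    moreover have "bracket a d \<in> U + V" "bracket b c \<in> U + V"
      using x(2,3) y(2,3) uv by simp_all
    ultimately show "bracket x y \<in> U + V"
      unfolding x(1) y(1) bracket_simps by (intro subspace_add[OF sUV])
  qed
  then show "join U V \<subseteq> U + V" using UV by (rule join_least)
  show "U + V \<subseteq> join U V"
  proof
    fix x assume "x \<in> U + V"
    then obtain u v where x: "x = u + v" "u \<in> U" "v \<in> V" by (rule set_plus_elim)
    have "u + v \<in> join U V"
      using x(2,3) join_upper1[of U V] join_upper2[of V U]
      by (intro subspace_add subalgebra_subspace subalgebra_join) auto
    then show "x \<in> join U V" by (simp only: x(1))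
  qed
qed

lemma weak_quasi_ideals_imp_modular:
  assumes wqi: "\<And>U. subalgebra U \<Longrightarrow> weak_quasi_ideal U"
  shows modular
  unfolding modular_def
proof (intro allI impI, elim conjE)
  fix U V W assume UVW: "subalgebra U" "subalgebra V" "subalgebra W" "U \<subseteq> W"
  note sW = subalgebra_subspace[OF UVW(3)]
  have "(U + V) \<inter> W = U + (V \<inter> W)"
  proof (intro equalityI subsetI)
    fix x assume "x \<in> (U + V) \<inter> W"
    then obtain u v where x: "x = u + v" "u \<in> U" "v \<in> V" "x \<in> W" by (auto elim: set_plus_elim)
    \<comment> \<open>As U lies in W, so does the other summand v = x - u. This is the modular law
      for subspaces.\<close>
    then have "x - u \<in> W" using UVW(4) subspace_diff[OF sW] by blast
    then show "x \<in> U + (V \<inter> W)" using x by auto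
  next
    fix x assume "x \<in> U + (V \<inter> W)"
    then obtain u v where "x = u + v" "u \<in> U" "v \<in> V" "v \<in> W" by (auto elim: set_plus_elim)
    then show "x \<in> (U + V) \<inter> W" using UVW(4) subspace_add[OF sW] by auto
  qed
  then show "join U V \<inter> W = join U (V \<inter> W)"
    using UVW by (simp add: join_eq_set_plus wqi subalgebra_Int)
qed

text \<open>For N between U and the join, modularity gives N = \<open>join U (B \<inter> N)\<close>.
  Here \<open>B \<inter> N\<close> lies between \<open>U \<inter> B\<close> and B, and it is not B
  unless N is the whole join. Maximality leaves \<open>B \<inter> N = U \<inter> B\<close>, so N =
  U.\<close>

lemma modular_imp_upper_semi_modular:
  assumes modular
  shows upper_semi_modular
  unfolding upper_semi_modular_def upper_semi_modular_in_def
proof (intro allI impI conjI, assumption, elim conjE)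
  fix U B assume U: "subalgebra U" and B: "subalgebra B" and max: "maximal_subalgebra (U \<inter> B) B"
  have "N = U" if N: "subalgebra N" "U \<subseteq> N" "N \<subset> join U B" for N
  proof -
    have N_eq: "N = join U (B \<inter> N)"
      using \<open>modular\<close> U B N unfolding modular_def by blast
    have "\<not> B \<subseteq> N" using N join_least by blast
    then have "N \<inter> B = U \<inter> B"
      using max N subalgebra_Int[OF N(1) B] unfolding maximal_subalgebra_def by blast
    then have "B \<inter> N \<subseteq> U" by blast
    then have "join U (B \<inter> N) \<subseteq> U" using U by (intro join_least) auto
    then show "N = U" using N_eq N(2) by blast
  qed
  moreover have "U \<noteq> join U B"
    using max join_upper2[of B U] unfolding maximal_subalgebra_def by blast
  ultimately show "maximal_subalgebra U (join U B)"
    using U subalgebra_join[of U B] join_upper1[of U B] unfolding maximal_subalgebra_def by blast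
qed

section \<open>The right center (Z in the overview) and subalgebras with one generator\<close>

definition right_center :: "'b set" where
  "right_center = {k. \<forall>x. bracket x k = 0}"

lemma bracket_right_center: "k \<in> right_center \<Longrightarrow> bracket x k = 0"
  by (simp add: right_center_def)

lemma subspace_right_center: "subspace right_center"
  by (auto simp: right_center_def subspace_def bracket_simps)

lemma right_center_ideal: "k \<in> right_center \<Longrightarrow> bracket k x \<in> right_center"
  by (auto simp: right_center_def leibniz)

text \<open>The right side of the Leibniz identity is alternating in y and z: it vanishes for y = z
  and changes sign when they are exchanged. The second fact gives the next lemma directly, in every
  characteristic.\<close>

lemma square_in_right_center: "bracket x x \<in> right_center"
  by (auto simp: right_center_def leibniz)

lemma anticommutator_in_right_center: "bracket x y + bracket y x \<in> right_center"
  by (auto simp: right_center_def bracket_simps leibniz)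

lemma subalgebra_of_right_center:
  "subspace J \<Longrightarrow> J \<subseteq> right_center \<Longrightarrow> subalgebra J"
  using subspace_0 by (auto simp: subalgebra_def bracket_right_center subset_iff)

abbreviation gen :: "'b \<Rightarrow> 'b set" where
  "gen x \<equiv> subalgebra hull {x}"

lemma gen_self: "x \<in> gen x"
  by (simp add: hull_inc)

lemma gen_least: "subalgebra U \<Longrightarrow> x \<in> U \<Longrightarrow> gen x \<subseteq> U"
  by (simp add: hull_minimal)

text \<open>The set is the sum F z + U. In this form, membership means being a multiple of z modulo
  U, which is how eigenvectors and codimension one are expressed below.\<close>

lemma subspace_line_plus: "subspace U \<Longrightarrow> subspace {w. \<exists>c. w - c *s z \<in> U}"
proof -
  assume U: "subspace U"
  show ?thesis
  proof (rule subspaceI)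
    show "0 \<in> {w. \<exists>c. w - c *s z \<in> U}"
      using subspace_0[OF U] by (auto intro: exI[of _ 0])
  next
    fix v w assume "v \<in> {w. \<exists>c. w - c *s z \<in> U}" "w \<in> {w. \<exists>c. w - c *s z \<in> U}"
    then obtain c d where "v - c *s z \<in> U" "w - d *s z \<in> U" by blast
    then have "(v - c *s z) + (w - d *s z) \<in> U" by (rule subspace_add[OF U])
    also have "(v - c *s z) + (w - d *s z) = (v + w) - (c + d) *s z"
      by (simp add: algebra_simps)
    finally show "v + w \<in> {w. \<exists>c. w - c *s z \<in> U}" by blast
  next
    fix a w assume "w \<in> {w. \<exists>c. w - c *s z \<in> U}"
    then obtain c where "w - c *s z \<in> U" by blast
    then have "a *s (w - c *s z) \<in> U" by (rule subspace_scale[OF U])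
    also have "a *s (w - c *s z) = a *s w - (a * c) *s z"
      by (simp add: algebra_simps)
    finally show "a *s w \<in> {w. \<exists>c. w - c *s z \<in> U}" by blast
  qed
qed

text \<open>By bilinearity only the three kinds of brackets that involve z have to be
  checked.\<close>

lemma subalgebra_line_plus:
  assumes U: "subalgebra U"
    and zz: "\<exists>c. bracket z z - c *s z \<in> U"
    and zu: "\<And>u. u \<in> U \<Longrightarrow> \<exists>c. bracket z u - c *s z \<in> U"
    and uz: "\<And>u. u \<in> U \<Longrightarrow> \<exists>c. bracket u z - c *s z \<in> U"
  shows "subalgebra {w. \<exists>c. w - c *s z \<in> U}"
proof -
  let ?W = "{w. \<exists>c. w - c *s z \<in> U}"
  have sW: "subspace ?W" by (intro subspace_line_plus subalgebra_subspace U)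
  have UW: "U \<subseteq> ?W" by (auto intro: exI[of _ 0])
  show ?thesis
  proof (rule subalgebraI[OF sW])
    fix v w assume "v \<in> ?W" "w \<in> ?W"
    then obtain c d where "v - c *s z \<in> U" "w - d *s z \<in> U" by blast
    then obtain a b where v: "v = c *s z + a" "a \<in> U" and w: "w = d *s z + b" "b \<in> U"
      by (metis add.commute diff_add_cancel)
    have "bracket z z \<in> ?W" "bracket z b \<in> ?W" "bracket a z \<in> ?W" "bracket a b \<in> ?W"
      using zz zu uz v w UW subalgebra_bracket[OF U] by blast+
    then show "bracket v w \<in> ?W"
      unfolding v w bracket_simps by (intro subspace_add[OF sW] subspace_scale[OF sW])
  qed
qed

text \<open>With S = \<open>gen x\<close> this yields \<open>gen x\<close> = F x + J for J =
  \<open>gen x \<inter> right_center\<close>. Squares lie in the right center, which is an ideal, so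
  the sum on the right is closed under brackets.\<close>

lemma gen_subset_line_plus:
  assumes "x \<in> S" "subalgebra S"
  shows "gen x \<subseteq> {w. \<exists>c. w - c *s x \<in> S \<inter> right_center}"
proof (rule gen_least)
  have s: "subalgebra (S \<inter> right_center)"
    by (intro subalgebra_Int subalgebra_of_right_center subspace_right_center assms order.refl)
  \<comment> \<open>The scalar 0 serves in all three conditions, since the brackets already lie in
    \<open>S \<inter> right_center\<close>.\<close>
  show "subalgebra {w. \<exists>c. w - c *s x \<in> S \<inter> right_center}"
    by (rule subalgebra_line_plus[OF s]; rule exI[of _ 0])
      (use assms subspace_0[OF subalgebra_subspace[OF s]] in
        \<open>auto simp: bracket_right_center square_in_right_center right_center_ideal subalgebra_bracket\<close>)
  show "x \<in> {w. \<exists>c. w - c *s x \<in> S \<inter> right_center}"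
    using subspace_0[OF subalgebra_subspace[OF s]] by (auto intro: exI[of _ 1])
qed

end

section \<open>From upper semi-modularity to weak quasi-ideals\<close>

locale fd_leibniz_algebra =
  leibniz_algebra scale bracket + fd_vector_space_over_alg_closed scale Basis
  for scale :: "'a::alg_closed_field \<Rightarrow> 'b::ab_group_add \<Rightarrow> 'b" (infixr \<open>*s\<close> 75)
    and bracket :: "'b \<Rightarrow> 'b \<Rightarrow> 'b" and Basis :: "'b set"
begin

text \<open>Right multiplication by an element of the right center is zero, so by \<open>Uy\<close>
  each element of U acts from the right as a multiple of y. Hence a single eigenvector z of right
  multiplication by y modulo U controls all brackets [z,u]. Then F z + U is a subalgebra, and by
  maximality it is S.\<close>

lemma maximal_subalgebra_codim_one:
  assumes max: "maximal_subalgebra U S"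
    and y: "y \<in> U" and Uy: "U \<subseteq> {w. \<exists>c. w - c *s y \<in> right_center}"
    and x: "x \<in> S" "x \<notin> U" and s: "s \<in> S"
  shows "\<exists>c. s - c *s x \<in> U"
proof -
  have U: "subalgebra U" and S: "subalgebra S" and US: "U \<subset> S"
    using max by (auto simp: maximal_subalgebra_def)
  note sU = subalgebra_subspace[OF U] and sS = subalgebra_subspace[OF S]
  let ?K = "right_center \<inter> S"
  \<comment> \<open>With this choice \<open>[u,z] + [z,u]\<close> and \<open>[z,z]\<close>, which lie in \<open>?K\<close>, cause no trouble: either
    \<open>?K\<close> lies in \<open>U\<close>, or \<open>z\<close> is in \<open>?K\<close> and \<open>[u,z] = [z,z] = 0\<close>.\<close>
  define T where "T = (if ?K \<subseteq> U then S else ?K)"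
  have "subspace T" unfolding T_def by (auto intro: subspace_inter subspace_right_center sS)
  moreover have "bracket t y \<in> T" if "t \<in> T" for t
    using that y US subalgebra_bracket[OF S] right_center_ideal
    by (auto simp: T_def split: if_splits)
  moreover have "\<not> T \<subseteq> U" using US by (auto simp: T_def)
  ultimately obtain z l where z: "z \<in> T" "z \<notin> U" "bracket z y - l *s z \<in> U"
    using exists_eigenvector_mod_subspace[OF linear_bracket_left sU, of T y] by blast
  let ?W = "{w. \<exists>c. w - c *s z \<in> U}"
  have sW: "subspace ?W" by (rule subspace_line_plus[OF sU])
  have UW: "U \<subseteq> ?W" by (auto intro: exI[of _ 0])
  have "z \<in> ?W" using subspace_0[OF sU] by (auto intro: exI[of _ 1])
  have zS: "z \<in> S" using z by (auto simp: T_def split: if_splits)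
  have T_cases: "?K \<subseteq> U \<or> z \<in> right_center"
    using z by (auto simp: T_def split: if_splits)
  have zu: "bracket z u \<in> ?W" if "u \<in> U" for u
  proof -
    obtain c where c: "u - c *s y \<in> right_center" using Uy \<open>u \<in> U\<close> by blast
    have "bracket z (u - c *s y) = 0" by (rule bracket_right_center[OF c])
    then have "bracket z u = c *s bracket z y" by (simp add: bracket_simps)
    moreover have "c *s bracket z y \<in> ?W"
      by (rule subspace_scale[OF sW]) (use z(3) in blast)
    ultimately show ?thesis by (simp only:)
  qed
  have uz: "bracket u z \<in> ?W" if "u \<in> U" for u
    using T_cases
  proof
    assume "?K \<subseteq> U"
    have "bracket u z + bracket z u \<in> S"
      using that US zS by (intro subspace_add[OF sS] subalgebra_bracket[OF S]) auto
    then have "bracket u z + bracket z u \<in> ?W"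
      using anticommutator_in_right_center \<open>?K \<subseteq> U\<close> UW by blast
    then show ?thesis using zu[OF that] subspace_diff[OF sW] by fastforce
  next
    assume "z \<in> right_center"
    then show ?thesis using subspace_0[OF sW] by (simp only: bracket_right_center)
  qed
  have zz: "bracket z z \<in> ?W"
    using T_cases
  proof
    assume "?K \<subseteq> U"
    then show ?thesis
      using square_in_right_center subalgebra_bracket[OF S zS zS] UW by blast
  next
    assume "z \<in> right_center"
    then show ?thesis using subspace_0[OF sW] by (simp only: bracket_right_center)
  qed
  have "subalgebra ?W"
    by (rule subalgebra_line_plus[OF U]) (use zz zu uz in blast)+
  moreover have "?W \<subseteq> S"
  proof
    fix w assume "w \<in> ?W"
    then obtain c where "w - c *s z \<in> S" using US by blast
    then have "w - c *s z + c *s z \<in> S" using zS by (intro subspace_add[OF sS] subspace_scale[OF sS])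
    then show "w \<in> S" by simp
  qed
  ultimately have "?W = S"
    using max UW \<open>z \<in> ?W\<close> z(2) unfolding maximal_subalgebra_def by blast
  then obtain a b where a: "x - a *s z \<in> U" and b: "s - b *s z \<in> U" using x(1) s by blast
  have "a \<noteq> 0" using a x(2) by auto
  \<comment> \<open>Both x and s are multiples of z modulo U. The one for x is nonzero, so z can be
    eliminated.\<close>
  have "(s - b *s z) - (b / a) *s (x - a *s z) \<in> U"
    by (intro subspace_diff[OF sU] subspace_scale[OF sU] a b)
  also have "(s - b *s z) - (b / a) *s (x - a *s z) = s - (b / a) *s x"
    using \<open>a \<noteq> 0\<close> by (simp add: scale_right_diff_distrib)
  finally show ?thesis ..
qed

text \<open>The parameter J allows two uses: J = 0 when x is in the right center, and then J =
  \<open>gen x \<inter> right_center\<close> for arbitrary x, once the first use has shown that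
  \<open>gen y + J\<close> is a subalgebra.\<close>

lemma bracket_in_sum_of_gens_aux:
  assumes usm: upper_semi_modular
    and J: "subspace J" "J \<subseteq> right_center" "J \<subseteq> gen x"
    and gen: "gen x \<subseteq> {w. \<exists>c. w - c *s x \<in> J}"
    and U: "subalgebra (gen y + J)"
  shows "bracket x y \<in> gen x + gen y"
proof -
  let ?U = "gen y + J"
  note sU = subalgebra_subspace[OF U]
  note gx = subalgebra_hull[of "{x}"] and gy = subalgebra_hull[of "{y}"]
  note sx = subalgebra_subspace[OF gx] and sy = subalgebra_subspace[OF gy]
  have JU: "J \<subseteq> ?U" by (rule subset_set_plus_right[OF sy])
  have yU: "y \<in> ?U" using subset_set_plus_left[OF J(1)] gen_self by blast
  have U_sub: "?U \<subseteq> gen x + gen y"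
    using set_plus_mono2[OF J(3) order.refl[of "gen y"]] by (simp only: add.commute[of J])
  have sxy: "subspace (gen x + gen y)" by (rule subspace_set_plus[OF sx sy])
  have x_sum: "x \<in> gen x + gen y"
    using subset_set_plus_left[OF sy] gen_self by blast
  show ?thesis
  proof (cases "x \<in> ?U")
    case True
    then show ?thesis using subalgebra_bracket[OF U _ yU] U_sub by blast
  next
    case False
    \<comment> \<open>J has codimension at most one in \<open>gen x\<close>, so a subspace
      containing J but not x meets \<open>gen x\<close> only in J. This serves both for the
      maximality of J in \<open>gen x\<close> and for the intersection of \<open>?U\<close> with
      \<open>gen x\<close>.\<close>
    have dichotomy: "N \<inter> gen x = J" if N: "subspace N" "J \<subseteq> N" "x \<notin> N" for N
    proof (intro equalityI subsetI)
      fix w assume w: "w \<in> N \<inter> gen x"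
      then obtain c where c: "w - c *s x \<in> J" using gen by blast
      have "c = 0"
      proof (rule ccontr)
        assume "c \<noteq> 0"
        have "w \<in> N" "w - c *s x \<in> N" using w c N(2) by auto
        then have "w - (w - c *s x) \<in> N" by (rule subspace_diff[OF N(1)])
        then have "inverse c *s (w - (w - c *s x)) \<in> N" by (rule subspace_scale[OF N(1)])
        then show False using \<open>c \<noteq> 0\<close> N(3) by simp
      qed
      then show "w \<in> J" using c by simp
    qed (use N J in auto)
    have "maximal_subalgebra J (gen x)"
      unfolding maximal_subalgebra_def
    proof (intro conjI allI impI)
      show "subalgebra J" using J by (intro subalgebra_of_right_center)
      show "subalgebra (gen x)" by (rule gx)
      show "J \<subset> gen x" using J(3) JU False gen_self by blast
    next
      fix N assume N: "subalgebra N \<and> J \<subseteq> N \<and> N \<subset> gen x"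
      then have "x \<notin> N" using gen_least by blast
      then show "N = J" using dichotomy[of N] N subalgebra_subspace by blast
    qed
    moreover have "?U \<inter> gen x = J" by (rule dichotomy[OF sU JU False])
    ultimately have max: "maximal_subalgebra ?U (join ?U (gen x))"
      using usm U gx unfolding upper_semi_modular_def upper_semi_modular_in_def by metis
    \<comment> \<open>This is the hypothesis \<open>Uy\<close> of the codimension lemma:
      \<open>gen y\<close> lies in F y plus the right center, and J lies in the right
      center.\<close>
    have "?U \<subseteq> {w. \<exists>c. w - c *s y \<in> right_center}"
    proof
      fix w assume "w \<in> ?U"
      then obtain a j where w: "w = a + j" "a \<in> gen y" "j \<in> J" by (auto elim: set_plus_elim)
      then obtain c where "a - c *s y \<in> right_center"
        using gen_subset_line_plus[OF gen_self gy] by blast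
      then have "(a - c *s y) + j \<in> right_center"
        using w J(2) by (intro subspace_add[OF subspace_right_center]) auto
      then show "w \<in> {w. \<exists>c. w - c *s y \<in> right_center}" using w by (auto simp: algebra_simps)
    qed
    moreover have xS: "x \<in> join ?U (gen x)" using join_upper2 gen_self by blast
    moreover have "bracket x y \<in> join ?U (gen x)"
      using subalgebra_bracket[OF subalgebra_join xS] join_upper1 yU by blast
    ultimately obtain c where "bracket x y - c *s x \<in> ?U"
      using maximal_subalgebra_codim_one[OF max yU] False by blast
    then have "bracket x y - c *s x + c *s x \<in> gen x + gen y"
      using U_sub x_sum by (intro subspace_add[OF sxy] subspace_scale[OF sxy]) auto
    then show ?thesis by simp
  qed
qed

text \<open>What remains is that \<open>gen y + ?J\<close> is a subalgebra. Modulo the right center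
  an element b of \<open>gen y\<close> is a multiple of y, so [j,b] is a multiple of [j,y] for j in
  \<open>?J\<close>. The case J = 0 of the previous lemma, with j in place of x, handles that
  bracket.\<close>

lemma bracket_in_sum_of_gens:
  assumes usm: upper_semi_modular
  shows "bracket x y \<in> gen x + gen y"
proof -
  let ?J = "gen x \<inter> right_center"
  note gx = subalgebra_hull[of "{x}"] and gy = subalgebra_hull[of "{y}"]
  note sx = subalgebra_subspace[OF gx] and sy = subalgebra_subspace[OF gy]
  have sJ: "subspace ?J" by (intro subspace_inter sx subspace_right_center)
  have sU: "subspace (gen y + ?J)" by (rule subspace_set_plus[OF sy sJ])
  have gyU: "gen y \<subseteq> gen y + ?J" by (rule subset_set_plus_left[OF sJ])
  have JU: "?J \<subseteq> gen y + ?J" by (rule subset_set_plus_right[OF sy])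
  have ky: "bracket k y \<in> gen y + ?J" if k: "k \<in> ?J" for k
  proof -
    \<comment> \<open>An element k of the right center has [k,k] = 0, so \<open>gen k\<close> is
      just the line F k and J = 0 is admissible.\<close>
    have "subalgebra (range (\<lambda>c. c *s k))"
    proof (rule subalgebra_of_right_center)
      show "subspace (range (\<lambda>c. c *s k))" using subspace_span[of "{k}"] by (simp add: span_singleton)
      show "range (\<lambda>c. c *s k) \<subseteq> right_center" using k subspace_scale[OF subspace_right_center] by blast
    qed
    then have gk: "gen k \<subseteq> range (\<lambda>c. c *s k)"
      by (rule gen_least) (metis rangeI scale_one)
    then have "gen k \<subseteq> {w. \<exists>c. w - c *s k \<in> {0}}" by auto
    moreover have "{0} \<subseteq> gen k"
      using subspace_0[OF subalgebra_subspace[OF subalgebra_hull]] by simp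
    moreover have "{0} \<subseteq> right_center"
      using subspace_0[OF subspace_right_center] by simp
    moreover have "subalgebra (gen y + {0})" using gy by (simp flip: set_zero)
    ultimately have "bracket k y \<in> gen k + gen y"
      by (intro bracket_in_sum_of_gens_aux[OF usm subspace_single_0])
    moreover have "gen k \<subseteq> ?J" using gk k subspace_scale[OF sJ] by blast
    ultimately have "bracket k y \<in> ?J + gen y" using set_plus_mono2[OF _ order.refl, of "gen k" ?J "gen y"] by blast
    then show ?thesis by (simp only: add.commute)
  qed
  have "subalgebra (gen y + ?J)"
  proof (rule subalgebraI[OF sU])
    fix v w assume "v \<in> gen y + ?J" "w \<in> gen y + ?J"
    obtain a j where v: "v = a + j" "a \<in> gen y" "j \<in> ?J"
      using \<open>v \<in> gen y + ?J\<close> by (rule set_plus_elim)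
    obtain b k where w: "w = b + k" "b \<in> gen y" "k \<in> ?J"
      using \<open>w \<in> gen y + ?J\<close> by (rule set_plus_elim)
    obtain c where c: "b - c *s y \<in> right_center"
      using gen_subset_line_plus[OF gen_self gy] w by blast
    have "bracket j (b - c *s y) = 0" by (rule bracket_right_center[OF c])
    then have "bracket j b = c *s bracket j y" by (simp add: bracket_simps)
    moreover have "c *s bracket j y \<in> gen y + ?J" by (rule subspace_scale[OF sU ky[OF v(3)]])
    ultimately have "bracket j b \<in> gen y + ?J" by (simp only:)
    moreover have "bracket a b \<in> gen y + ?J" using subalgebra_bracket[OF gy] v w gyU by blast
    \<comment> \<open>Brackets with k on the right vanish, so [j,b] was the only mixed bracket to
      estimate.\<close>
    moreover have "bracket a k = 0" "bracket j k = 0" using w by (auto simp: bracket_right_center)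
    ultimately show "bracket v w \<in> gen y + ?J"
      unfolding v(1) w(1) bracket_simps by (simp add: subspace_add[OF sU])
  qed
  then show ?thesis
    using gen_subset_line_plus[OF gen_self gx]
    by (intro bracket_in_sum_of_gens_aux[OF usm sJ]) auto
qed

text \<open>The condition can be tested on single pairs u, v, because \<open>gen u + gen v\<close>
  lies in U + V.\<close>

lemma upper_semi_modular_imp_weak_quasi_ideal:
  assumes usm: upper_semi_modular and U: "subalgebra U"
  shows "weak_quasi_ideal U"
  unfolding weak_quasi_ideal_def
proof (intro conjI allI impI U)
  fix V assume V: "subalgebra V"
  have sUV: "subspace (U + V)" by (intro subspace_set_plus subalgebra_subspace U V)
  have uv: "bracket u v \<in> U + V" "bracket v u \<in> U + V" if "u \<in> U" "v \<in> V" for u v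
  proof -
    have "gen u \<subseteq> U" "gen v \<subseteq> V" using that by (auto intro!: gen_least U V del: subsetI)
    then have "gen u + gen v \<subseteq> U + V" by (rule set_plus_mono2)
    then show "bracket u v \<in> U + V" "bracket v u \<in> U + V"
      using bracket_in_sum_of_gens[OF usm, of u v] bracket_in_sum_of_gens[OF usm, of v u]
      by (auto simp: add.commute)
  qed
  have sub: "bracket_space U V \<subseteq> U + V" "bracket_space V U \<subseteq> U + V"
    unfolding bracket_space_def by (intro span_minimal sUV; use uv in blast)+
  show "bracket_space U V + bracket_space V U \<subseteq> U + V"
  proof
    fix x assume "x \<in> bracket_space U V + bracket_space V U"
    then obtain a b where x: "x = a + b" "a \<in> bracket_space U V" "b \<in> bracket_space V U"
      by (rule set_plus_elim)
    then show "x \<in> U + V"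
      unfolding x(1) using sub by (intro subspace_add[OF sUV]) (rule subsetD, assumption+)+
  qed
qed

end

theorem mainTheorem7:
  fixes scale :: "'a::alg_closed_field \<Rightarrow> 'b::ab_group_add \<Rightarrow> 'b"
    and bracket :: "'b \<Rightarrow> 'b \<Rightarrow> 'b"
    and Basis :: "'b set"
  assumes "leibniz_algebra scale bracket"
    and "finite_dimensional_vector_space scale Basis"
  shows "(leibniz_algebra.modular scale bracket \<longleftrightarrow>
            (\<forall>U. leibniz_algebra.subalgebra scale bracket U \<longrightarrow>
               leibniz_algebra.weak_quasi_ideal scale bracket U))
       \<and> ((\<forall>U. leibniz_algebra.subalgebra scale bracket U \<longrightarrow>
               leibniz_algebra.weak_quasi_ideal scale bracket U) \<longleftrightarrow>
            leibniz_algebra.upper_semi_modular scale bracket)"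
proof -
  interpret fd_leibniz_algebra scale bracket Basis
    by (intro fd_leibniz_algebra.intro fd_vector_space_over_alg_closed.intro assms)
  \<comment> \<open>The implications (ii) to (i), (i) to (iii) and (iii) to (ii) close a
    cycle.\<close>
  show ?thesis
    using weak_quasi_ideals_imp_modular modular_imp_upper_semi_modular
      upper_semi_modular_imp_weak_quasi_ideal by blast
qed

end
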